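(* Let $A$ and $B$ be totally symmetric Latin squares of order $n$ with $n\not\equiv 0\pmod 3$. If $A$ and $B$ are paratopic, then $A$ and $B$ are isomorphic.
   Context: A Latin square of order $n$ is an $n\times n$ array with rows, columns and symbols indexed by $\{1,\dots,n\}$, each row and column containing each symbol once; equivalently a set of $n^2$ triples (row, column, symbol), distinct triples agreeing in at most one coordinate. The conjugates of a Latin square are obtained by applying a fixed permutation of the three coordinates to every triple. A Latin square is totally symmetric if it equals all six of its conjugates. An isotopism $(\alpha,\beta,\gamma)\in\mathcal{S}_n^3$ maps each triple $(r,c,s)$ to $(r^\alpha,c^\beta,s^\gamma)$; it is an isomorphism if $\alpha=\beta=\gamma$. A paratopism is an isotopism combined with taking a conjugate; two squares are paratopic (isomorphic) if some paratopism (isomorphism) maps one to the other. *)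

theory Defs
  imports "HOL-Combinatorics.Permutations" "HOL-Number_Theory.Cong"
begin

type_synonym triple = "nat \<times> nat \<times> nat"

fun coord :: "triple \<Rightarrow> nat \<Rightarrow> nat" where
  "coord (r, c, s) i = (if i = 1 then r else if i = 2 then c else s)"

text \<open>
  A Latin square is identified with its set of (row, column, symbol) triples;
  the lemma \<open>latin_square_iff_array\<close> below relates this to the description as an array.
\<close>

definition latin_square :: "nat \<Rightarrow> triple set \<Rightarrow> bool" where
  "latin_square n L \<longleftrightarrow>
     L \<subseteq> {1..n} \<times> {1..n} \<times> {1..n} \<and> card L = n\<^sup>2 \<and>
     (\<forall>t\<in>L. \<forall>u\<in>L. t \<noteq> u \<longrightarrow> card {i \<in> {1, 2, 3}. coord t i = coord u i} \<le> 1)"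

definition conjugate :: "(nat \<Rightarrow> nat) \<Rightarrow> triple set \<Rightarrow> triple set" where
  "conjugate \<sigma> L = (\<lambda>t. (coord t (\<sigma> 1), coord t (\<sigma> 2), coord t (\<sigma> 3))) ` L"

definition totally_symmetric :: "triple set \<Rightarrow> bool" where
  "totally_symmetric L \<longleftrightarrow> (\<forall>\<sigma>. \<sigma> permutes {1, 2, 3} \<longrightarrow> conjugate \<sigma> L = L)"

definition isotope ::
    "(nat \<Rightarrow> nat) \<Rightarrow> (nat \<Rightarrow> nat) \<Rightarrow> (nat \<Rightarrow> nat) \<Rightarrow> triple set \<Rightarrow> triple set" where
  "isotope \<alpha> \<beta> \<gamma> L = (\<lambda>(r, c, s). (\<alpha> r, \<beta> c, \<gamma> s)) ` L"

definition isomorphic :: "nat \<Rightarrow> triple set \<Rightarrow> triple set \<Rightarrow> bool" where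
  "isomorphic n A B \<longleftrightarrow> (\<exists>\<alpha>. \<alpha> permutes {1..n} \<and> isotope \<alpha> \<alpha> \<alpha> A = B)"

definition paratopic :: "nat \<Rightarrow> triple set \<Rightarrow> triple set \<Rightarrow> bool" where
  "paratopic n A B \<longleftrightarrow>
     (\<exists>\<sigma> \<alpha> \<beta> \<gamma>. \<sigma> permutes {1, 2, 3} \<and>
        \<alpha> permutes {1..n} \<and> \<beta> permutes {1..n} \<and> \<gamma> permutes {1..n} \<and>
        isotope \<alpha> \<beta> \<gamma> (conjugate \<sigma> A) = B)"

lemma card_agree_le_1_iff:
  "card {i \<in> {1, 2, 3}. coord (r, c, s) i = coord (r', c', s') i} \<le> 1 \<longleftrightarrow>
     \<not> (r = r' \<and> c = c') \<and> \<not> (r = r' \<and> s = s') \<and> \<not> (c = c' \<and> s = s')"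
proof -
  have "{i \<in> {1, 2, 3}. coord (r, c, s) i = coord (r', c', s') i} =
      (if r = r' then {1} else {}) \<union> (if c = c' then {2} else {}) \<union> (if s = s' then {3} else {})"
    by auto
  then show ?thesis by simp
qed

lemma latin_square_iff_array:
  "latin_square n L \<longleftrightarrow>
     (\<exists>f. L = {(r, c, f r c) | r c. r \<in> {1..n} \<and> c \<in> {1..n}} \<and>
          (\<forall>r\<in>{1..n}. bij_betw (\<lambda>c. f r c) {1..n} {1..n}) \<and>
          (\<forall>c\<in>{1..n}. bij_betw (\<lambda>r. f r c) {1..n} {1..n}))"
  (is "?lhs \<longleftrightarrow> ?rhs")
proof
  assume ?lhs
  then have sub: "L \<subseteq> {1..n} \<times> {1..n} \<times> {1..n}" and card: "card L = n\<^sup>2"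
    and small: "\<And>t u. t \<in> L \<Longrightarrow> u \<in> L \<Longrightarrow> t \<noteq> u \<Longrightarrow>
      card {i \<in> {1, 2, 3}. coord t i = coord u i} \<le> 1"
    unfolding latin_square_def by blast+
  have agree: "\<not> (r = r' \<and> c = c') \<and> \<not> (r = r' \<and> s = s') \<and> \<not> (c = c' \<and> s = s')"
    if "(r, c, s) \<in> L" "(r', c', s') \<in> L" "(r, c, s) \<noteq> (r', c', s')" for r c s r' c' s'
    using small[OF that] unfolding card_agree_le_1_iff .
  let ?p = "\<lambda>(r, c, s). (r, c) :: nat \<times> nat"
  have inj: "inj_on ?p L"
  proof (rule inj_onI)
    fix t u assume "t \<in> L" "u \<in> L" "?p t = ?p u"
    then show "t = u" using agree by (cases t, cases u) fastforce
  qed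
  have "?p ` L = {1..n} \<times> {1..n}"
  proof (rule card_subset_eq)
    show "card (?p ` L) = card ({1..n} \<times> {1..n})"
      using card_image[OF inj] card by (simp add: power2_eq_square)
  qed (use sub in auto)
  then have "\<forall>r\<in>{1..n}. \<forall>c\<in>{1..n}. \<exists>s. (r, c, s) \<in> L" by force
  then obtain f where f: "\<And>r c. r \<in> {1..n} \<Longrightarrow> c \<in> {1..n} \<Longrightarrow> (r, c, f r c) \<in> L"
    by metis
  have L: "L = {(r, c, f r c) | r c. r \<in> {1..n} \<and> c \<in> {1..n}}"
  proof (intro equalityI subsetI)
    fix t assume t: "t \<in> L"
    obtain r c s where rcs: "t = (r, c, s)" by (cases t)
    with t sub have mem: "r \<in> {1..n}" "c \<in> {1..n}" by auto
    then have "s = f r c" using agree[OF _ f[OF mem]] t rcs by blast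
    then show "t \<in> {(r, c, f r c) | r c. r \<in> {1..n} \<and> c \<in> {1..n}}"
      using rcs mem by blast
  qed (use f in blast)
  have bij: "bij_betw g {1..n} {1..n}" if "g ` {1..n} \<subseteq> {1..n}" "inj_on g {1..n}" for g :: "nat \<Rightarrow> nat"
    using that endo_inj_surj[of "{1..n}" g] by (simp add: bij_betw_def)
  have im: "f r c \<in> {1..n}" if "r \<in> {1..n}" "c \<in> {1..n}" for r c
    using f[OF that] sub by auto
  have "bij_betw (\<lambda>c. f r c) {1..n} {1..n}" if r: "r \<in> {1..n}" for r
  proof (rule bij)
    show "inj_on (f r) {1..n}"
      by (rule inj_onI) (use agree[OF f[OF r] f[OF r]] in blast)
  qed (use im r in blast)
  moreover have "bij_betw (\<lambda>r. f r c) {1..n} {1..n}" if c: "c \<in> {1..n}" for c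
  proof (rule bij)
    show "inj_on (\<lambda>r. f r c) {1..n}"
      by (rule inj_onI) (use agree[OF f[OF _ c] f[OF _ c]] in blast)
  qed (use im c in blast)
  ultimately show ?rhs using L by blast
next
  assume ?rhs
  then obtain f where L: "L = {(r, c, f r c) | r c. r \<in> {1..n} \<and> c \<in> {1..n}}"
    and row: "\<And>r. r \<in> {1..n} \<Longrightarrow> bij_betw (\<lambda>c. f r c) {1..n} {1..n}"
    and col: "\<And>c. c \<in> {1..n} \<Longrightarrow> bij_betw (\<lambda>r. f r c) {1..n} {1..n}"
    by blast
  have Lim: "L = (\<lambda>(r, c). (r, c, f r c)) ` ({1..n} \<times> {1..n})"
    unfolding L by auto
  have "card L = n\<^sup>2"
    unfolding Lim by (subst card_image) (auto simp: inj_on_def power2_eq_square)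
  moreover have "L \<subseteq> {1..n} \<times> {1..n} \<times> {1..n}"
    unfolding L using bij_betwE[OF row] by blast
  moreover have "card {i \<in> {1, 2, 3}. coord t i = coord u i} \<le> 1"
    if "t \<in> L" "u \<in> L" "t \<noteq> u" for t u
  proof -
    from that obtain r c r' c' where tu: "t = (r, c, f r c)" "u = (r', c', f r' c')"
      and mem: "r \<in> {1..n}" "c \<in> {1..n}" "r' \<in> {1..n}" "c' \<in> {1..n}"
      unfolding L by blast
    have "\<not> (r = r' \<and> f r c = f r' c')"
      using that(3) tu mem inj_onD[OF bij_betw_imp_inj_on[OF row], of r c c'] by blast
    moreover have "\<not> (c = c' \<and> f r c = f r' c')"
      using that(3) tu mem inj_onD[OF bij_betw_imp_inj_on[OF col], of c r r'] by blast
    ultimately show ?thesis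
      unfolding tu card_agree_le_1_iff using that(3) tu by blast
  qed
  ultimately show ?lhs unfolding latin_square_def by blast
qed

end

theory Submission
  imports Defs "HOL-Combinatorics.Cycles"
begin

text \<open>
  Since \<open>A\<close> is totally symmetric, \<open>B\<close> is an isotope of it, say by \<open>(\<alpha>, \<beta>, \<gamma>)\<close>. Renaming \<open>B\<close>
  along \<open>\<beta>\<close> we may take \<open>\<beta> = 1\<close>. Total symmetry of both squares lets a permutation occurring in
  the isotopism slide from one coordinate of \<open>B\<close> to another, so the isotopism may be replaced by
  \<open>(\<tau>, 1, 1)\<close> with \<open>\<tau> = \<gamma>\<alpha>\<close>, where \<open>\<tau>\<close> slides as well. A sliding permutation with a fixed point
  is trivial, so \<open>\<tau>\<close> is semiregular, and its order is prime to 3 because \<open>n\<close> is. Hence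
  \<open>\<tau> = \<psi>\<^sup>3\<close> for a power \<open>\<psi>\<close> of \<open>\<tau>\<close>, and sliding turns \<open>(\<psi>\<^sup>3, 1, 1)\<close> into the isomorphism
  \<open>(\<psi>, \<psi>, \<psi>)\<close>.
\<close>

text \<open>The orbits of \<open>p\<close> partition \<open>S\<close> into blocks of size
  three.\<close>

lemma three_dvd_card_if_cube_id_no_fixpoint:
  assumes "finite S" and maps: "\<And>x. x \<in> S \<Longrightarrow> p x \<in> S"
    and cube: "\<And>x. x \<in> S \<Longrightarrow> p (p (p x)) = x"
    and nofix: "\<And>x. x \<in> S \<Longrightarrow> p x \<noteq> x"
  shows "3 dvd card S"
proof -
  let ?C = "(\<lambda>x. {x, p x, p (p x)}) ` S"
  have union: "\<Union> ?C = S" using maps by auto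
  have "card c = 3" if c: "c \<in> ?C" for c
  proof -
    obtain x where x: "x \<in> S" "c = {x, p x, p (p x)}" using c by blast
    have "p (p x) \<noteq> x" using cube nofix x(1) by metis
    moreover have "p (p x) \<noteq> p x" "p x \<noteq> x" using nofix maps x(1) by blast+
    ultimately show ?thesis by (simp add: x(2) card_insert_if eq_commute)
  qed
  moreover have "c \<inter> d = {}" if cd: "c \<in> ?C" "d \<in> ?C" "c \<noteq> d" for c d
  proof -
    \<comment> \<open>Any element of a block generates it, so distinct blocks are disjoint.\<close>
    have orbit: "c = {y, p y, p (p y)}" if c: "c \<in> ?C" "y \<in> c" for c y
    proof -
      obtain x where x: "x \<in> S" "c = {x, p x, p (p x)}" using c(1) by blast
      with c(2) consider "y = x" | "y = p x" | "y = p (p x)" by blast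
      then show ?thesis
        by cases (simp_all add: x(2) cube[OF x(1)] insert_commute)
    qed
    have False if "y \<in> c" "y \<in> d" for y
      using orbit[OF cd(1) that(1)] orbit[OF cd(2) that(2)] cd(3) by simp
    then show ?thesis by blast
  qed
  ultimately have "3 dvd card (\<Union> ?C)"
    by (intro dvd_partition) (use assms(1) union in auto)
  then show ?thesis using union by simp
qed

text \<open>Here \<open>T x y z\<close> says that the cell in row \<open>x\<close> and column \<open>y\<close> holds \<open>z\<close>.\<close>

locale totally_symmetric_square =
  fixes S :: "'a set" and T :: "'a \<Rightarrow> 'a \<Rightarrow> 'a \<Rightarrow> bool"
  assumes fin: "finite S"
    and swap12: "T x y z \<longleftrightarrow> T y x z"
    and swap23: "T x y z \<longleftrightarrow> T x z y"
    and symbol_unique: "T x y z \<Longrightarrow> T x y z' \<Longrightarrow> z = z'"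
    and column_exists: "x \<in> S \<Longrightarrow> z \<in> S \<Longrightarrow> \<exists>y. T x y z"
begin

text \<open>For a bijection \<open>p\<close> this says that \<open>p\<close>, its inverse and the
  identity, in this order, form an autotopism of the square.\<close>

definition slides :: "('a \<Rightarrow> 'a) \<Rightarrow> bool" where
  "slides p \<longleftrightarrow> (\<forall>x y z. T (p x) y z \<longleftrightarrow> T x (p y) z)"

lemma slides12: "slides p \<Longrightarrow> T (p x) y z \<longleftrightarrow> T x (p y) z"
  by (simp add: slides_def)

lemma slides13: "slides p \<Longrightarrow> T (p x) y z \<longleftrightarrow> T x y (p z)"
  using slides12 swap23 by metis

text \<open>Sliding one factor at a time reverses their order, which is harmless for powers of a
  single map.\<close>

lemma slides_funpow:
  assumes "slides p"
  shows "slides (p ^^ k)"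
proof (induction k)
  case (Suc k)
  have "T ((p ^^ Suc k) x) y z \<longleftrightarrow> T x ((p ^^ Suc k) y) z" for x y z
  proof -
    have "T ((p ^^ Suc k) x) y z \<longleftrightarrow> T x ((p ^^ k) (p y)) z"
      using slides12[OF assms] slides12[OF Suc] by simp
    then show ?thesis by (simp only: funpow_Suc_right o_apply)
  qed
  then show ?case unfolding slides_def by blast
qed (simp add: slides_def)

text \<open>In the row of a fixed point, sliding \<open>p\<close> onto the symbol shows that the
  cell holding \<open>z\<close> also holds \<open>p z\<close>.\<close>

lemma slides_fixpoint_imp_id:
  assumes "slides p" "x \<in> S" "p x = x" "z \<in> S"
  shows "p z = z"
proof -
  obtain y where y: "T x y z" using column_exists assms(2,4) by blast
  then have "T x y (p z)" using slides13[OF assms(1), of x y z] assms(3) by simp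
  with y show ?thesis using symbol_unique by blast
qed

lemma slides_cube_root:
  assumes "slides p" and perm: "p permutes S" and card: "\<not> 3 dvd card S"
  obtains k where "p ^^ (k + k + k) = p"
proof -
  define m where "m = (LEAST m. m > 0 \<and> p ^^ m = id)"
  have "\<exists>m. m > 0 \<and> p ^^ m = id"
    using permutation_is_nilpotent fin perm unfolding permutation_permutes by metis
  then have m: "m > 0" "p ^^ m = id"
    unfolding m_def by (metis (mono_tags, lifting) LeastI_ex)+
  have min: "p ^^ j \<noteq> id" if "0 < j" "j < m" for j
    using not_less_Least[of j "\<lambda>m. m > 0 \<and> p ^^ m = id"] that unfolding m_def by blast
  have "\<not> 3 dvd m"
  proof
    assume "3 dvd m"
    then obtain j where "m = 3 * j" by (rule dvdE)
    then have j: "m = j + j + j" by simp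
    \<comment> \<open>If 3 divided the order \<open>m\<close>, this nontrivial power would have cube
      \<open>id\<close> and no fixed point in \<open>S\<close>, so 3 would divide
      \<open>card S\<close>.\<close>
    let ?q = "p ^^ j"
    have q: "?q permutes S"
      using perm by (rule permutes_funpow)
    have cube: "?q (?q (?q x)) = x" for x
      using m(2) unfolding j funpow_add by (metis comp_apply id_apply)
    have "?q \<noteq> id" using min[of j] m(1) j by linarith
    then obtain z where z: "?q z \<noteq> z" by (auto simp: fun_eq_iff)
    then have "z \<in> S" using q by (meson permutes_not_in)
    then have "?q x \<noteq> x" if "x \<in> S" for x
      using slides_fixpoint_imp_id[OF slides_funpow[OF assms(1)] that] z by blast
    then have "3 dvd card S"
      using three_dvd_card_if_cube_id_no_fixpoint[OF fin, of ?q] cube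
        permutes_in_image[OF q] by blast
    with card show False ..
  qed
  then have "m = 3 * (m div 3) + 1 \<or> m = 3 * (m div 3) + 2"
    by presburger
  \<comment> \<open>In either case a multiple of 3 is congruent to 1 modulo \<open>m\<close>:
    \<open>m + m + 1\<close> in the first, \<open>m + 1\<close> in the second.\<close>
  then consider q where "m = 3 * q + 1" | q where "m = 3 * q + 2" by metis
  then show thesis
  proof cases
    case 1
    have "p ^^ (m + m + 1) = p" using m(2) by (simp only: funpow_add) simp
    moreover have "m + m + 1 = (2 * q + 1) + (2 * q + 1) + (2 * q + 1)" using 1 by simp
    ultimately show thesis using that by metis
  next
    case 2
    have "p ^^ (m + 1) = p" using m(2) by (simp only: funpow_add) simp
    moreover have "m + 1 = (q + 1) + (q + 1) + (q + 1)" using 2 by simp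
    ultimately show thesis using that by metis
  qed
qed

end

lemma isotope_eq_iff:
  assumes "bij \<alpha>" "bij \<beta>" "bij \<gamma>"
  shows "isotope \<alpha> \<beta> \<gamma> A = B \<longleftrightarrow> (\<forall>x y z. (x, y, z) \<in> A \<longleftrightarrow> (\<alpha> x, \<beta> y, \<gamma> z) \<in> B)"
proof -
  have mem: "(\<alpha> x, \<beta> y, \<gamma> z) \<in> isotope \<alpha> \<beta> \<gamma> A \<longleftrightarrow> (x, y, z) \<in> A" for x y z
    using assms[THEN bij_is_inj] by (force simp: isotope_def dest: injD)
  have onto: "\<exists>x y z. t = (\<alpha> x, \<beta> y, \<gamma> z)" for t
    using assms[THEN bij_is_surj] by (metis prod_cases3 surjD)
  show ?thesis
  proof
    assume R: "\<forall>x y z. (x, y, z) \<in> A \<longleftrightarrow> (\<alpha> x, \<beta> y, \<gamma> z) \<in> B"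
    have "t \<in> isotope \<alpha> \<beta> \<gamma> A \<longleftrightarrow> t \<in> B" for t
      using onto[of t] mem R by auto
    then show "isotope \<alpha> \<beta> \<gamma> A = B" by blast
  qed (use mem in blast)
qed

lemma totally_symmetric_swaps:
  assumes "totally_symmetric L"
  shows "(x, y, z) \<in> L \<longleftrightarrow> (y, x, z) \<in> L" "(x, y, z) \<in> L \<longleftrightarrow> (x, z, y) \<in> L"
proof -
  have 1: "conjugate (transpose 1 2) L = L" and 2: "conjugate (transpose 2 3) L = L"
    using assms by (auto simp: totally_symmetric_def intro!: permutes_swap_id)
  have "(y, x, z) \<in> L" if "(x, y, z) \<in> L" for x y z
    using that by (subst 1[symmetric]) (force simp: conjugate_def transpose_def)
  then show "(x, y, z) \<in> L \<longleftrightarrow> (y, x, z) \<in> L" by blast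
  have "(x, z, y) \<in> L" if "(x, y, z) \<in> L" for x y z
    using that by (subst 2[symmetric]) (force simp: conjugate_def transpose_def)
  then show "(x, y, z) \<in> L \<longleftrightarrow> (x, z, y) \<in> L" by blast
qed

lemma latin_square_symbol_unique:
  assumes "latin_square n L" "(x, y, z) \<in> L" "(x, y, z') \<in> L"
  shows "z = z'"
  using assms unfolding latin_square_iff_array by blast

lemma latin_square_column_exists:
  assumes "latin_square n L" "x \<in> {1..n}" "z \<in> {1..n}"
  shows "\<exists>y\<in>{1..n}. (x, y, z) \<in> L"
proof -
  obtain f where L: "L = {(r, c, f r c) | r c. r \<in> {1..n} \<and> c \<in> {1..n}}"
    and "bij_betw (f x) {1..n} {1..n}"
    using assms(1,2) unfolding latin_square_iff_array by blast
  then obtain y where "y \<in> {1..n}" "f x y = z"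
    using assms(3) unfolding bij_betw_def by (metis imageE)
  then show ?thesis using assms(2) unfolding L by blast
qed

theorem theorem15:
  fixes n :: nat and A B :: "triple set"
  assumes "latin_square n A" and "totally_symmetric A"
    and "latin_square n B" and "totally_symmetric B"
    and "\<not> [n = 0] (mod 3)"
    and "paratopic n A B"
  shows "isomorphic n A B"
proof -
  let ?S = "{1..n}"
  obtain \<sigma> \<alpha> \<beta> \<gamma> where \<sigma>: "\<sigma> permutes {1, 2, 3}"
    and perm: "\<alpha> permutes ?S" "\<beta> permutes ?S" "\<gamma> permutes ?S"
    and "isotope \<alpha> \<beta> \<gamma> (conjugate \<sigma> A) = B"
    using assms(6) unfolding paratopic_def by blast
  moreover have "conjugate \<sigma> A = A" using assms(2) \<sigma> by (simp add: totally_symmetric_def)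
  ultimately have AB: "(x, y, z) \<in> A \<longleftrightarrow> (\<alpha> x, \<beta> y, \<gamma> z) \<in> B" for x y z
    using isotope_eq_iff perm[THEN permutes_bij] by metis
  note swapA = totally_symmetric_swaps[OF assms(2)]
  note swapB = totally_symmetric_swaps[OF assms(4)]
  \<comment> \<open>Pulling \<open>B\<close> back along \<open>\<beta>\<close> makes the column map
    of the isotopism trivial.\<close>
  define T where "T x y z \<longleftrightarrow> (\<beta> x, \<beta> y, \<beta> z) \<in> B" for x y z
  interpret totally_symmetric_square ?S T
  proof
    show "\<exists>y. T x y z" if "x \<in> ?S" "z \<in> ?S" for x z
      using latin_square_column_exists[OF assms(3)] that permutes_in_image[OF perm(2)]
      unfolding T_def by (metis permutes_surj[OF perm(2)] surjD)
    show "z = z'" if "T x y z" "T x y z'" for x y z z'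
      using latin_square_symbol_unique[OF assms(3)] that permutes_inj[OF perm(2)]
      unfolding T_def by (metis injD)
  qed (use swapB in \<open>auto simp: T_def\<close>)
  define \<theta> where "\<theta> = inv \<beta> \<circ> \<alpha>"
  define \<phi> where "\<phi> = inv \<beta> \<circ> \<gamma>"
  have perm': "\<theta> permutes ?S" "\<phi> permutes ?S"
    unfolding \<theta>_def \<phi>_def using perm by (auto intro!: permutes_compose permutes_inv)
  have AT: "(x, y, z) \<in> A \<longleftrightarrow> T (\<theta> x) y (\<phi> z)" for x y z
    unfolding AB T_def \<theta>_def \<phi>_def using permutes_inverses(1)[OF perm(2)] by simp
  \<comment> \<open>Write the symbol as a value of \<open>\<phi>\<close>, pass to \<open>A\<close>,
    exchange row and column there, and return.\<close>
  have "T (\<theta> x) y z \<longleftrightarrow> T x (\<theta> y) z" for x y z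
    using AT[of x y] AT[of y x] swapA(1) swap12 permutes_surj[OF perm'(2)] by (metis surjD)
  then have \<theta>: "slides \<theta>" by (simp add: slides_def)
  have "T x y (\<phi> z) \<longleftrightarrow> T x (\<phi> y) z" for x y z
    using AT[of _ y z] AT[of _ z y] swapA(2) swap23 permutes_surj[OF perm'(1)] by (metis surjD)
  then have \<phi>: "slides \<phi>" unfolding slides_def using swap12 swap23 by metis
  define \<tau> where "\<tau> = \<phi> \<circ> \<theta>"
  have \<tau>: "\<tau> permutes ?S" unfolding \<tau>_def using perm' by (intro permutes_compose)
  have A\<tau>: "(x, y, z) \<in> A \<longleftrightarrow> T (\<tau> x) y z" for x y z
    unfolding AT \<tau>_def using slides13[OF \<phi>] by simp
  \<comment> \<open>Sliding the two factors in turn would only give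
    \<open>\<theta> \<circ> \<phi>\<close> on the column; the symmetry of \<open>A\<close> gives
    \<open>\<tau>\<close> itself.\<close>
  have "slides \<tau>"
    unfolding slides_def using A\<tau> swapA(1) swap12 by metis
  moreover have "\<not> 3 dvd card ?S" using assms(5) by (simp add: cong_0_iff)
  ultimately obtain k where k: "\<tau> ^^ (k + k + k) = \<tau>"
    using slides_cube_root \<tau> by blast
  define \<psi> where "\<psi> = \<tau> ^^ k"
  have cube: "\<tau> = \<psi> \<circ> \<psi> \<circ> \<psi>" using k by (simp add: \<psi>_def funpow_add)
  have \<psi>: "slides \<psi>" unfolding \<psi>_def using \<open>slides \<tau>\<close> by (rule slides_funpow)
  have "\<psi> permutes ?S"
    unfolding \<psi>_def using \<tau> by (rule permutes_funpow)
  then have \<delta>: "(\<beta> \<circ> \<psi>) permutes ?S" using perm(2) by (rule permutes_compose)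
  \<comment> \<open>One factor \<open>\<psi>\<close> stays on the row; the other two slide to the
    column and the symbol.\<close>
  have "T (\<tau> x) y z \<longleftrightarrow> T (\<psi> x) (\<psi> y) (\<psi> z)" for x y z
    unfolding cube using slides12[OF \<psi>] slides13[OF \<psi>] by simp
  then have "(x, y, z) \<in> A \<longleftrightarrow> ((\<beta> \<circ> \<psi>) x, (\<beta> \<circ> \<psi>) y, (\<beta> \<circ> \<psi>) z) \<in> B" for x y z
    using A\<tau> by (simp add: T_def)
  then have "isotope (\<beta> \<circ> \<psi>) (\<beta> \<circ> \<psi>) (\<beta> \<circ> \<psi>) A = B"
    using isotope_eq_iff permutes_bij[OF \<delta>] by blast
  with \<delta> show ?thesis unfolding isomorphic_def by blast
qed

end
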